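(* Let $n$ be a prime number. Then: (i) $M_n\equiv 1 \pmod n$, where $M_n$ is the $n$-th Mersenne number; (ii) $L_n\equiv 1 \pmod n$, where $L_n$ is the $n$-th Lucas number; (iii) $Q_n\equiv 2 \pmod n$, where $Q_n$ is the $n$-th Pell-Lucas number; (iv) $j_n\equiv 1 \pmod n$, where $j_n$ is the $n$-th Jacobsthal-Lucas number; (v) for all integers $P,Q$, the value $\dfrac{V_n(P,Q)-P^n}{n}$ is an integer, and $V_n(P,Q)\equiv P \pmod n$, where $V_n(P,Q)$ is the $n$-th term of the Lucas sequence with parameters $P,Q$.
   Context: For $n\ge 1$: $M_n=2^n-1$; $L_n=\left(\frac{1+\sqrt5}{2}\right)^n+\left(\frac{1-\sqrt5}{2}\right)^n$; $Q_n=(1+\sqrt2)^n+(1-\sqrt2)^n$; $j_n=2^n+(-1)^n$; and, for integers $P,Q$, $$V_n(P,Q)=\left(\frac{P+\sqrt{P^2-4Q}}{2}\right)^n+\left(\frac{P-\sqrt{P^2-4Q}}{2}\right)^n,$$ where $\sqrt{P^2-4Q}$ denotes a fixed complex square root (the value does not depend on the choice). All these numbers are integers. *)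

theory Defs
  imports Complex_Main "HOL-Number_Theory.Number_Theory"
begin

definition mersenne :: "nat \<Rightarrow> int" where
  "mersenne n = 2 ^ n - 1"

definition lucas_number :: "nat \<Rightarrow> real" where
  "lucas_number n = ((1 + sqrt 5) / 2) ^ n + ((1 - sqrt 5) / 2) ^ n"

definition pell_lucas :: "nat \<Rightarrow> real" where
  "pell_lucas n = (1 + sqrt 2) ^ n + (1 - sqrt 2) ^ n"

definition jacobsthal_lucas :: "nat \<Rightarrow> int" where
  "jacobsthal_lucas n = 2 ^ n + (- 1) ^ n"

text \<open>The discriminant may be negative, so the values are taken in the complex numbers.
  The principal square root is used; any other choice gives the same value, see
  \<open>lucas_V_any_root\<close> below.\<close>

definition lucas_V :: "int \<Rightarrow> int \<Rightarrow> nat \<Rightarrow> complex" where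
  "lucas_V P Q n =
     ((of_int P + csqrt (of_int (P\<^sup>2 - 4 * Q))) / 2) ^ n +
     ((of_int P - csqrt (of_int (P\<^sup>2 - 4 * Q))) / 2) ^ n"

lemma lucas_V_any_root:
  assumes "s\<^sup>2 = of_int (P\<^sup>2 - 4 * Q)"
  shows "lucas_V P Q n = ((of_int P + s) / 2) ^ n + ((of_int P - s) / 2) ^ n"
proof -
  have "s\<^sup>2 = (csqrt (of_int (P\<^sup>2 - 4 * Q)))\<^sup>2"
    using assms by (simp only: power2_csqrt)
  then consider "s = csqrt (of_int (P\<^sup>2 - 4 * Q))" | "s = - csqrt (of_int (P\<^sup>2 - 4 * Q))"
    unfolding power2_eq_iff by blast
  then show ?thesis
    by cases (simp_all only: lucas_V_def diff_minus_eq_add add_uminus_conv_diff add.commute)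
qed

end

theory Submission
  imports Defs
begin

text \<open>Let \<open>a\<close> and \<open>b\<close> be the roots of \<open>x\<^sup>2 - P x + Q\<close>, so that \<open>V\<^sub>n(P,Q) = a\<^sup>n + b\<^sup>n\<close>.
  The binomial theorem gives
  \<open>P\<^sup>n = (a + b)\<^sup>n = a\<^sup>n + b\<^sup>n + n S\<close>, where \<open>S\<close> is the sum over \<open>0 < k < n\<close> of
  \<open>((n choose k) / n) a\<^sup>k b\<^bsup>n-k\<^esup>\<close>. For prime \<open>n\<close> the coefficients of \<open>S\<close> are integers, and they
  are unchanged under \<open>k \<mapsto> n - k\<close>; hence \<open>S\<close> is a symmetric polynomial in \<open>a\<close> and \<open>b\<close> with integer
  coefficients, and so an integer (\<open>symmetric_form_in_Ints\<close>), although \<open>a\<close> and \<open>b\<close> need not even be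
  rational. Thus \<open>(V\<^sub>n - P\<^sup>n) / n = - S\<close> is an integer, and Fermat's little theorem
  \<open>P\<^sup>n \<equiv> P\<close> yields \<open>V\<^sub>n \<equiv> P\<close> modulo \<open>n\<close>.

  The other sequences are all values of \<open>V\<close>: the Lucas numbers are \<open>V(1,-1)\<close>, the Pell-Lucas
  numbers \<open>V(2,-1)\<close>, the Jacobsthal-Lucas numbers \<open>V(1,-2)\<close> (roots \<open>2\<close> and \<open>-1\<close>), and
  \<open>M\<^sub>n = V\<^sub>n(3,2) - 2\<close> (roots \<open>2\<close> and \<open>1\<close>). To treat them together, the argument is carried out
  for two elements \<open>a\<close> and \<open>b\<close> of an arbitrary commutative ring whose sum and product are
  integers.\<close>

lemma power_sum_in_Ints:
  fixes a b :: "'a::comm_ring_1"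
  assumes "a + b \<in> \<int>" "a * b \<in> \<int>"
  shows "a ^ m + b ^ m \<in> \<int>"
proof (induction m rule: induct_nat_012)
  case (ge2 m)
  have "a ^ Suc (Suc m) + b ^ Suc (Suc m) =
      (a + b) * (a ^ Suc m + b ^ Suc m) - a * b * (a ^ m + b ^ m)"
    by (simp add: algebra_simps)
  then show ?case
    using ge2 assms by (metis Ints_diff Ints_mult)
qed (use assms in auto)

text \<open>The two outer terms of the form combine to a multiple of a power sum, and what remains is
  \<open>a b\<close> times a symmetric form of degree smaller by \<open>2\<close>. Peeling from both ends treats even and
  odd degrees alike, with no separate middle term.\<close>

lemma symmetric_form_in_Ints:
  fixes a b :: "'a::comm_ring_1" and c :: "nat \<Rightarrow> int"
  assumes ab: "a + b \<in> \<int>" "a * b \<in> \<int>"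
    and "\<And>k. k \<le> m \<Longrightarrow> c (m - k) = c k"
  shows "(\<Sum>k\<le>m. of_int (c k) * a ^ k * b ^ (m - k)) \<in> \<int>"
  using assms(3)
proof (induction m arbitrary: c rule: induct_nat_012)
  case 0
  then show ?case by simp
next
  case 1
  have "c 1 = c 0"
    using 1[of 0] by simp
  then have "(\<Sum>k\<le>Suc 0. of_int (c k) * a ^ k * b ^ (Suc 0 - k)) = of_int (c 0) * (a + b)"
    by (simp add: algebra_simps)
  then show ?case
    using ab by simp
next
  case (ge2 m)
  have outer: "c (Suc (Suc m)) = c 0"
    using ge2.prems[of 0] by simp
  have inner: "c (Suc (m - k)) = c (Suc k)" if "k \<le> m" for k
    using ge2.prems[of "Suc k"] that by (simp add: Suc_diff_le)
  have "(\<Sum>k\<le>Suc (Suc m). of_int (c k) * a ^ k * b ^ (Suc (Suc m) - k)) =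
      of_int (c 0) * b ^ Suc (Suc m) +
      (\<Sum>k\<le>m. of_int (c (Suc k)) * a ^ Suc k * b ^ (Suc m - k)) +
      of_int (c (Suc (Suc m))) * a ^ Suc (Suc m)"
    by (subst sum.atMost_Suc_shift) simp
  also have "(\<Sum>k\<le>m. of_int (c (Suc k)) * a ^ Suc k * b ^ (Suc m - k)) =
      a * b * (\<Sum>k\<le>m. of_int (c (Suc k)) * a ^ k * b ^ (m - k))"
    unfolding sum_distrib_left
    by (intro sum.cong refl) (simp add: Suc_diff_le algebra_simps)
  finally have "(\<Sum>k\<le>Suc (Suc m). of_int (c k) * a ^ k * b ^ (Suc (Suc m) - k)) =
      of_int (c 0) * (a ^ Suc (Suc m) + b ^ Suc (Suc m)) +
      a * b * (\<Sum>k\<le>m. of_int (c (Suc k)) * a ^ k * b ^ (m - k))"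
    unfolding outer by (simp only: algebra_simps)
  then show ?case
    using ge2.IH(1)[of "\<lambda>k. c (Suc k)"] inner power_sum_in_Ints[OF ab] ab(2)
    by (metis (no_types, lifting) Ints_add Ints_mult Ints_of_int)
qed

lemma prime_power_sum:
  fixes a b :: "'a::comm_ring_1"
  assumes "prime n" and ab: "a + b \<in> \<int>" "a * b \<in> \<int>"
  obtains s :: int where "(a + b) ^ n = a ^ n + b ^ n + of_nat n * of_int s"
proof -
  \<comment> \<open>The two extreme coefficients are set to \<open>0\<close>: they account for \<open>a\<^sup>n + b\<^sup>n\<close>, and
    \<open>1 div n\<close> would not be their quotient by \<open>n\<close>.\<close>
  define c :: "nat \<Rightarrow> int" where
    "c k = (if k = 0 \<or> k = n then 0 else int ((n choose k) div n))" for k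
  have n0: "n > 0"
    using \<open>prime n\<close> by (rule prime_gt_0_nat)
  have "c (n - k) = c k" if "k \<le> n" for k
    using that binomial_symmetric[OF that] by (auto simp: c_def)
  then have "(\<Sum>k\<le>n. of_int (c k) * a ^ k * b ^ (n - k)) \<in> \<int>"
    by (rule symmetric_form_in_Ints[OF ab])
  then obtain s where s: "(\<Sum>k\<le>n. of_int (c k) * a ^ k * b ^ (n - k)) = of_int s"
    by (rule Ints_cases)
  have coeff: "of_nat (n choose k) =
      (if k = n then 1 else 0) + (if k = 0 then 1 else 0) + of_nat n * (of_int (c k) :: 'a)"
    if "k \<le> n" for k
  proof (cases "k = 0 \<or> k = n")
    case True
    then show ?thesis
      using n0 by (auto simp: c_def)
  next
    case False
    then have "n dvd n choose k"
      using \<open>prime n\<close> that by (intro dvd_choose_prime) auto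
    then have "n * ((n choose k) div n) = n choose k"
      by simp
    then have "of_nat n * of_nat ((n choose k) div n) = (of_nat (n choose k) :: 'a)"
      by (metis of_nat_mult)
    then show ?thesis
      using False by (simp add: c_def)
  qed
  have "(a + b) ^ n = (\<Sum>k\<le>n. of_nat (n choose k) * a ^ k * b ^ (n - k))"
    by (rule binomial_ring)
  also have "\<dots> = (\<Sum>k\<le>n. (if k = n then a ^ n else 0) + (if k = 0 then b ^ n else 0) +
      of_nat n * (of_int (c k) * a ^ k * b ^ (n - k)))"
    using n0 by (intro sum.cong refl) (auto simp: coeff algebra_simps)
  also have "\<dots> = a ^ n + b ^ n + of_nat n * of_int s"
    by (simp add: sum.distrib flip: s sum_distrib_left)
  finally show ?thesis
    by (rule that)
qed

lemma fermat_int: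
  fixes x :: int
  assumes "prime n"
  shows "[x ^ n = x] (mod int n)"
proof (cases "int n dvd x")
  case True
  then have "int n dvd x ^ n"
    using prime_gt_0_nat[OF assms] by (simp add: dvd_power_le dvd_trans[OF _ dvd_power])
  then show ?thesis
    using True by (simp add: cong_iff_dvd_diff)
next
  case False
  have n0: "n > 0"
    using assms by (rule prime_gt_0_nat)
  define y where "y = nat (x mod int n)"
  have y: "[int y = x] (mod int n)"
    using n0 by (simp add: y_def cong_def)
  have "\<not> n dvd y"
    using False cong_dvd_iff[OF y] by simp
  then have "[y ^ (n - 1) = 1] (mod n)"
    by (rule fermat_theorem[OF assms])
  then have "[y ^ (n - 1) * y = 1 * y] (mod n)"
    by (rule cong_scalar_right)
  then have "[y ^ n = y] (mod n)"
    using n0 by (simp add: power_eq_if mult.commute)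
  then have "[int y ^ n = int y] (mod int n)"
    by (simp flip: cong_int_iff)
  then show ?thesis
    using y cong_pow[OF y, of n] by (meson cong_sym cong_trans)
qed

text \<open>Division by \<open>n\<close> may be impossible in the ring; the witness \<open>s\<close> therefore stands for the
  integer \<open>(P\<^sup>n - v) / n\<close>.\<close>

lemma prime_power_sum_cong:
  fixes a b :: "'a::comm_ring_1" and P Q :: int
  assumes "prime n" and P: "a + b = of_int P" and Q: "a * b = of_int Q"
  obtains v s :: int where "a ^ n + b ^ n = of_int v" "v = P ^ n - int n * s"
    "[v = P] (mod int n)"
proof -
  obtain s where s: "(a + b) ^ n = a ^ n + b ^ n + of_nat n * of_int s"
    by (rule prime_power_sum[of n a b]) (use assms in simp_all)
  define v where "v = P ^ n - int n * s"
  have "a ^ n + b ^ n = of_int v"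
    using s by (simp add: v_def P algebra_simps)
  moreover have "[v = P] (mod int n)"
  proof -
    have "[v = P ^ n] (mod int n)"
      by (simp add: v_def cong_iff_dvd_diff)
    then show ?thesis
      using fermat_int[OF \<open>prime n\<close>] by (rule cong_trans)
  qed
  ultimately show ?thesis
    using that v_def by blast
qed

theorem mainTheorem4:
  fixes n :: nat
  assumes "prime n"
  shows "[mersenne n = 1] (mod int n) \<and>
    (\<exists>l::int. lucas_number n = of_int l \<and> [l = 1] (mod int n)) \<and>
    (\<exists>q::int. pell_lucas n = of_int q \<and> [q = 2] (mod int n)) \<and>
    [jacobsthal_lucas n = 1] (mod int n) \<and>
    (\<forall>P Q :: int.
       (lucas_V P Q n - of_int P ^ n) / of_nat n \<in> \<int> \<and>
       (\<exists>v::int. lucas_V P Q n = of_int v \<and> [v = P] (mod int n)))"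
proof (intro conjI allI)
  have "[2 ^ n + 1 ^ n = (3::int)] (mod int n)"
    by (rule prime_power_sum_cong[OF assms, of "2::int" 1 3 2]) simp_all
  then have "[2 ^ n + 1 ^ n - 2 = 3 - (2::int)] (mod int n)"
    by (intro cong_diff cong_refl)
  then show "[mersenne n = 1] (mod int n)"
    by (simp add: mersenne_def)
next
  have "(1 + sqrt 5) / 2 + (1 - sqrt 5) / 2 = of_int 1"
      "(1 + sqrt 5) / 2 * ((1 - sqrt 5) / 2) = of_int (-1)"
    by (simp_all add: field_simps)
  then show "\<exists>l::int. lucas_number n = of_int l \<and> [l = 1] (mod int n)"
    unfolding lucas_number_def by (metis prime_power_sum_cong[OF assms])
next
  have "(1 + sqrt 2) + (1 - sqrt 2) = of_int 2" "(1 + sqrt 2) * (1 - sqrt 2) = of_int (-1)"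
    by (simp_all add: algebra_simps)
  then show "\<exists>q::int. pell_lucas n = of_int q \<and> [q = 2] (mod int n)"
    unfolding pell_lucas_def by (metis prime_power_sum_cong[OF assms])
next
  show "[jacobsthal_lucas n = 1] (mod int n)"
    unfolding jacobsthal_lucas_def
    by (rule prime_power_sum_cong[OF assms, of "2::int" "-1" 1 "-2"]) simp_all
next
  fix P Q :: int
  define r where "r = csqrt (of_int (P\<^sup>2 - 4 * Q))"
  have "r * r = of_int (P\<^sup>2 - 4 * Q)"
    unfolding r_def by (metis power2_csqrt power2_eq_square)
  then have "(of_int P + r) / 2 * ((of_int P - r) / 2) = of_int Q"
    by (simp add: field_simps power2_eq_square)
  moreover have "(of_int P + r) / 2 + (of_int P - r) / 2 = of_int P"
    by (simp add: field_simps)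
  ultimately obtain v s where v: "lucas_V P Q n = of_int v" "v = P ^ n - int n * s"
      "[v = P] (mod int n)"
    unfolding lucas_V_def r_def by (metis prime_power_sum_cong[OF assms])
  have "(lucas_V P Q n - of_int P ^ n) / of_nat n = of_int (- s)"
    using prime_gt_0_nat[OF assms] by (simp add: v(1,2))
  then show "(lucas_V P Q n - of_int P ^ n) / of_nat n \<in> \<int>"
    by (metis Ints_of_int)
  show "\<exists>v::int. lucas_V P Q n = of_int v \<and> [v = P] (mod int n)"
    using v by blast
qed

end
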